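(* Let $n\ge 1$ be an integer, $[a,b]$ a real interval with $a<b$, and $q$ a real number such that $[n]_q!\neq 0$ and $d(a,b;q^{i})\neq 0$ for $i=0,1,\ldots,n$. Let $\mathbf{b}_0,\ldots,\mathbf{b}_n\in\mathbb{R}^m$ ($m\ge 1$) and let $P(x)=\sum_{k=0}^{n}\mathbf{b}_kB^n_k(x;q)$, $a\le x\le b$, be the quantum trigonometric B\'ezier curve over $[a,b]$ with control points $\mathbf{b}_k$. For $x\in[a,b]$ set $\tilde b^{0}_{k}(x)=\bar b^{0}_{k}(x)=\mathbf{b}_k$ for $k=0,1,\ldots,n$, and define recursively, for $r=0,1,\ldots,n-1$ and $k=0,1,\ldots,n-r-1$, (Algorithm 1) $$\tilde b^{r+1}_{k}(x)=q^{k}\,\frac{d(x,b;q^{n-r-k-1})}{d(a,b;q^{n-r-1})}\,\tilde b^{r}_{k}(x)+\frac{d(a,x;q^{k})}{d(a,b;q^{n-r-1})}\,\tilde b^{r}_{k+1}(x),$$ (Algorithm 2) $$\bar b^{r+1}_{k}(x)=\frac{d(x,b;q^{n-r-k-1})}{d(a,b;q^{n-r-1})}\,\bar b^{r}_{k}(x)+q^{n-r-k-1}\,\frac{d(a,x;q^{k})}{d(a,b;q^{n-r-1})}\,\bar b^{r}_{k+1}(x).$$ Then for all $r=0,1,\ldots,n$, $k=0,1,\ldots,n-r$ and $x\in[a,b]$, $$\tilde b^{r}_{k}(x)=\sum_{j=0}^{r}q^{k(r-j)}\,\mathbf{b}_{k+j}\,{r\brack j}_q\,\frac{\prod_{i=0}^{j-1}d(a,x;q^{i+k})\cdot\prod_{i=0}^{r-j-1}d(x,b;q^{i+n-r-k})}{\prod_{i=0}^{r-1}d(a,b;q^{i+n-r})}$$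 and $$\bar b^{r}_{k}(x)=\sum_{j=0}^{r}q^{j(n-r-k)}\,\mathbf{b}_{k+j}\,{r\brack j}_q\,\frac{\prod_{i=0}^{j-1}d(a,x;q^{i+k})\cdot\prod_{i=0}^{r-j-1}d(x,b;q^{i+n-r-k})}{\prod_{i=0}^{r-1}d(a,b;q^{i+n-r})}.$$ In particular, $\tilde b^{n}_{0}(x)=\bar b^{n}_{0}(x)=P(x)$.
   Context: For real $x,y,q$ put $d(x,y;q):=\frac{q+1}{2}\sin(y-x)+\frac{q-1}{2}\sin(y+x)$. The $q$-integers are $[m]_q=\frac{1-q^m}{1-q}$ if $q\ne 1$ and $[m]_1=m$; the $q$-factorials are $[m]_q!=[m]_q[m-1]_q\cdots[1]_q$ for $m\ge 1$ and $[0]_q!=1$; the $q$-binomial coefficients are ${r\brack j}_q=\frac{[r]_q!}{[j]_q!\,[r-j]_q!}$ for $0\le j\le r$. The quantum trigonometric Bernstein basis functions of degree $n$ over $[a,b]$ (defined when $d(a,b;q^i)\ne 0$ for $i=0,\ldots,n$) are $$B^{n}_{k}(x;q)={n\brack k}_{q}\,\frac{\prod_{i=0}^{k-1}d(a,x;q^{i})\cdot\prod_{i=0}^{n-k-1}d(x,b;q^{i})}{\prod_{i=0}^{n-1}d(a,b;q^{i})},\qquad k=0,1,\ldots,n.$$ Empty products equal $1$, and $q^0=1$ for every $q$. *)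

theory Defs
  imports "HOL-Analysis.Analysis"
begin

definition qd :: "real \<Rightarrow> real \<Rightarrow> real \<Rightarrow> real" where
  "qd x y q = (q + 1) / 2 * sin (y - x) + (q - 1) / 2 * sin (y + x)"

definition qint :: "nat \<Rightarrow> real \<Rightarrow> real" where
  "qint m q = (if q = 1 then real m else (1 - q ^ m) / (1 - q))"

definition qfact :: "nat \<Rightarrow> real \<Rightarrow> real" where
  "qfact m q = (\<Prod>i=1..m. qint i q)"

text \<open>Meaningful for \<open>j \<le> r\<close> and \<open>qfact r q \<noteq> 0\<close> only.\<close>

definition qbinom :: "nat \<Rightarrow> nat \<Rightarrow> real \<Rightarrow> real" where
  "qbinom r j q = qfact r q / (qfact j q * qfact (r - j) q)"

definition qtrig_bernstein ::
  "real \<Rightarrow> real \<Rightarrow> real \<Rightarrow> nat \<Rightarrow> nat \<Rightarrow> real \<Rightarrow> real" where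
  "qtrig_bernstein a b q n k x =
     qbinom n k q *
     (((\<Prod>i<k. qd a x (q ^ i)) * (\<Prod>i<n - k. qd x b (q ^ i))) / (\<Prod>i<n. qd a b (q ^ i)))"

definition qtrig_bezier ::
  "real \<Rightarrow> real \<Rightarrow> real \<Rightarrow> nat \<Rightarrow> (nat \<Rightarrow> real ^ 'm) \<Rightarrow> real \<Rightarrow> real ^ 'm" where
  "qtrig_bezier a b q n c x = (\<Sum>k=0..n. qtrig_bernstein a b q n k x *\<^sub>R c k)"

text \<open>The two de Casteljau-type algorithms, with control points \<open>c\<close>; the arguments \<open>r\<close> and
  \<open>k\<close> are the upper and the lower index. Only the entries with \<open>r \<le> n\<close> and \<open>k \<le> n - r\<close>
  are meaningful: for these no subtraction below truncates, and the recursion uses only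
  entries in the same range.\<close>

primrec casteljau1 ::
  "real \<Rightarrow> real \<Rightarrow> real \<Rightarrow> nat \<Rightarrow> (nat \<Rightarrow> real ^ 'm) \<Rightarrow> real \<Rightarrow> nat \<Rightarrow> nat \<Rightarrow> real ^ 'm" where
  "casteljau1 a b q n c x 0 = (\<lambda>k. c k)"
| "casteljau1 a b q n c x (Suc r) = (\<lambda>k.
     (q ^ k * (qd x b (q ^ (n - r - k - 1)) / qd a b (q ^ (n - r - 1)))) *\<^sub>R
       casteljau1 a b q n c x r k
     + (qd a x (q ^ k) / qd a b (q ^ (n - r - 1))) *\<^sub>R
       casteljau1 a b q n c x r (k + 1))"

primrec casteljau2 ::
  "real \<Rightarrow> real \<Rightarrow> real \<Rightarrow> nat \<Rightarrow> (nat \<Rightarrow> real ^ 'm) \<Rightarrow> real \<Rightarrow> nat \<Rightarrow> nat \<Rightarrow> real ^ 'm" where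
  "casteljau2 a b q n c x 0 = (\<lambda>k. c k)"
| "casteljau2 a b q n c x (Suc r) = (\<lambda>k.
     (qd x b (q ^ (n - r - k - 1)) / qd a b (q ^ (n - r - 1))) *\<^sub>R
       casteljau2 a b q n c x r k
     + (q ^ (n - r - k - 1) * (qd a x (q ^ k) / qd a b (q ^ (n - r - 1)))) *\<^sub>R
       casteljau2 a b q n c x r (k + 1))"

end

theory Submission
  imports Defs
begin

text \<open>Up to powers of \<open>q\<close>, both algorithms multiply the same products of values of \<open>d\<close>, and
  these products obey the same two one-step recursions. Matching the coefficients of the control
  points leaves the two \<open>q\<close>-Pascal identities
  \<open>[r+1, j+1] = [r, j+1] + q^(r-j) [r, j]\<close> (Algorithm 1) and
  \<open>[r+1, j+1] = q^(j+1) [r, j+1] + [r, j]\<close> (Algorithm 2).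
  No trigonometric identity is involved.\<close>

section \<open>q-integers and the two q-Pascal identities\<close>

text \<open>For \<open>q\<close> other than 1, split \<open>1 - q^(m+l)\<close> as
  \<open>(1 - q^m) + q^m (1 - q^l)\<close>. The right-hand side is not symmetric in \<open>m\<close>
  and \<open>l\<close>; its two orders yield the two q-Pascal identities.\<close>

lemma qint_add: "qint (m + l) q = qint m q + q ^ m * qint l q"
proof (cases "q = 1")
  case False
  then show ?thesis
    by (simp add: qint_def power_add field_simps)
qed (simp add: qint_def)

lemma qfact_0 [simp]: "qfact 0 q = 1"
  by (simp add: qfact_def)

lemma qfact_Suc [simp]: "qfact (Suc m) q = qfact m q * qint (Suc m) q"
  by (simp add: qfact_def)

lemma qfact_nonzero_mono: "qfact n q \<noteq> 0 \<Longrightarrow> m \<le> n \<Longrightarrow> qfact m q \<noteq> 0"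
  by (auto simp: qfact_def)

lemma qbinom_0: "qfact r q \<noteq> 0 \<Longrightarrow> qbinom r 0 q = 1"
  by (simp add: qbinom_def)

lemma qbinom_self: "qfact r q \<noteq> 0 \<Longrightarrow> qbinom r r q = 1"
  by (simp add: qbinom_def)

text \<open>With the common factor \<open>[r]! / ([j+1]! [r-j]!)\<close> taken out, the three
  q-binomials become \<open>[r+1]\<close>, \<open>[r-j]\<close> and \<open>[j+1]\<close>, so each
  identity is one way of splitting \<open>[r+1]\<close>. The case \<open>j = r\<close> is excluded
  because truncated subtraction makes \<open>qbinom r (Suc r) q\<close> equal to
  \<open>1 / [r+1]\<close> instead of 0.\<close>

lemma qbinom_Suc_Suc:
  assumes "qfact (Suc r) q \<noteq> 0" "j < r"
  shows "qbinom (Suc r) (Suc j) q = qbinom r (Suc j) q + q ^ (r - j) * qbinom r j q"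
    and "qbinom (Suc r) (Suc j) q = q ^ Suc j * qbinom r (Suc j) q + qbinom r j q"
proof -
  \<comment> \<open>Writing \<open>r = j + l + 1\<close> removes truncated subtraction from all
    three q-binomials.\<close>
  define l where "l = r - Suc j"
  have r: "r = Suc (j + l)"
    using assms(2) by (simp add: l_def)
  have nz: "qfact j q \<noteq> 0" "qfact l q \<noteq> 0" "qint (Suc j) q \<noteq> 0" "qint (Suc l) q \<noteq> 0"
    using qfact_nonzero_mono[OF assms(1), of "Suc j"] qfact_nonzero_mono[OF assms(1), of "Suc l"]
    by (simp_all add: r)
  have bin: "qbinom (Suc r) (Suc j) q =
      qfact r q * qint (Suc r) q /
        (qfact j q * qint (Suc j) q * (qfact l q * qint (Suc l) q))"
    "qbinom r (Suc j) q = qfact r q / (qfact j q * qint (Suc j) q * qfact l q)"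
    "qbinom r j q = qfact r q / (qfact j q * (qfact l q * qint (Suc l) q))"
    by (simp_all add: qbinom_def r Suc_diff_le)
  have 1: "qint (Suc r) q = qint (Suc l) q + q ^ Suc l * qint (Suc j) q"
    using qint_add[of "Suc l" "Suc j" q] by (simp add: r add.commute)
  have 2: "qint (Suc r) q = qint (Suc j) q + q ^ Suc j * qint (Suc l) q"
    using qint_add[of "Suc j" "Suc l" q] by (simp add: r)
  have rj: "r - j = Suc l"
    by (simp add: r)
  show "qbinom (Suc r) (Suc j) q = qbinom r (Suc j) q + q ^ (r - j) * qbinom r j q"
    unfolding bin 1 rj using nz by (simp add: divide_simps) (simp add: algebra_simps)
  show "qbinom (Suc r) (Suc j) q = q ^ Suc j * qbinom r (Suc j) q + qbinom r j q"
    unfolding bin 2 using nz by (simp add: divide_simps) (simp add: algebra_simps)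
qed

section \<open>Products of values of \<open>d\<close> and their recursions\<close>

text \<open>The factor that the closed forms of both algorithms share. In the exponents the addition
  binds first: \<open>i + n - r - k\<close> is \<open>((i + n) - r) - k\<close>.\<close>

definition qtrig_weight ::
  "real \<Rightarrow> real \<Rightarrow> real \<Rightarrow> nat \<Rightarrow> real \<Rightarrow> nat \<Rightarrow> nat \<Rightarrow> nat \<Rightarrow> real" where
  "qtrig_weight a b q n x r k j =
     ((\<Prod>i<j. qd a x (q ^ (i + k))) * (\<Prod>i<r - j. qd x b (q ^ (i + n - r - k)))) /
     (\<Prod>i<r. qd a b (q ^ (i + n - r)))"

lemma qtrig_weight_0 [simp]: "qtrig_weight a b q n x 0 k 0 = 1"
  by (simp add: qtrig_weight_def)

lemma qtrig_weight_denominator_Suc: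
  assumes "r < n"
  shows "(\<Prod>i<Suc r. qd a b (q ^ (i + n - Suc r))) =
    qd a b (q ^ (n - r - 1)) * (\<Prod>i<r. qd a b (q ^ (i + n - r)))"
  by (subst prod.lessThan_Suc_shift) simp

text \<open>Raising \<open>r\<close> lowers the starting exponent of the \<open>b\<close>-product
  and of the denominator by one, so each gains a new first factor; the \<open>a\<close>-product does
  not depend on \<open>r\<close>.\<close>

lemma qtrig_weight_Suc_left:
  assumes "k + r < n" "j \<le> r"
  shows "qtrig_weight a b q n x (Suc r) k j =
    qd x b (q ^ (n - r - k - 1)) / qd a b (q ^ (n - r - 1)) * qtrig_weight a b q n x r k j"
proof -
  have "(\<Prod>i<Suc r - j. qd x b (q ^ (i + n - Suc r - k))) =
      qd x b (q ^ (n - r - k - 1)) * (\<Prod>i<r - j. qd x b (q ^ (i + n - r - k)))"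
    using assms by (simp add: Suc_diff_le prod.lessThan_Suc_shift diff_commute del: prod.lessThan_Suc)
  moreover have "r < n"
    using assms by simp
  ultimately show ?thesis
    unfolding qtrig_weight_def qtrig_weight_denominator_Suc[OF \<open>r < n\<close>] by simp
qed

text \<open>Passing from \<open>(r, k+1)\<close> to \<open>(r+1, k)\<close> leaves
  \<open>n - r - k\<close> lowered by one in both cases, so the \<open>b\<close>-products agree; the
  \<open>a\<close>-product gains its factor at exponent \<open>k\<close>.\<close>

lemma qtrig_weight_Suc_right:
  assumes "k + r < n" "j \<le> r"
  shows "qtrig_weight a b q n x (Suc r) k (Suc j) =
    qd a x (q ^ k) / qd a b (q ^ (n - r - 1)) * qtrig_weight a b q n x r (Suc k) j"
proof -
  have "(\<Prod>i<Suc j. qd a x (q ^ (i + k))) = qd a x (q ^ k) * (\<Prod>i<j. qd a x (q ^ (i + Suc k)))"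
    by (subst prod.lessThan_Suc_shift) simp
  moreover have "(\<Prod>i<Suc r - Suc j. qd x b (q ^ (i + n - Suc r - k))) =
      (\<Prod>i<r - j. qd x b (q ^ (i + n - r - Suc k)))"
    by simp
  moreover have "r < n"
    using assms by simp
  ultimately show ?thesis
    unfolding qtrig_weight_def qtrig_weight_denominator_Suc[OF \<open>r < n\<close>] by simp
qed

text \<open>Comparison of the coefficients of each control point. The two end coefficients receive
  only one summand and are kept apart, so \<open>A (Suc r)\<close> and its ill-defined q-binomial
  never occur.\<close>

lemma sum_scaleR_two_term_recursion:
  fixes c :: "nat \<Rightarrow> 'a::real_vector"
  assumes "F 0 = s * A 0" "F (Suc r) = t * B r"
    and "\<And>j. j < r \<Longrightarrow> F (Suc j) = s * A (Suc j) + t * B j"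
  shows "s *\<^sub>R (\<Sum>j=0..r. A j *\<^sub>R c (k + j)) + t *\<^sub>R (\<Sum>j=0..r. B j *\<^sub>R c (Suc k + j)) =
    (\<Sum>j=0..Suc r. F j *\<^sub>R c (k + j))"
proof -
  \<comment> \<open>Splitting off the first term of the \<open>A\<close>-sum and the last term of
    the \<open>B\<close>-sum leaves two sums over the same \<open>j < r\<close> and the same control
    points.\<close>
  have A: "(\<Sum>j=0..r. A j *\<^sub>R c (k + j)) =
      A 0 *\<^sub>R c k + (\<Sum>j<r. A (Suc j) *\<^sub>R c (Suc k + j))"
    by (simp add: atMost_atLeast0[symmetric] lessThan_Suc_atMost[symmetric]
        sum.lessThan_Suc_shift del: sum.lessThan_Suc)
  have B: "(\<Sum>j=0..r. B j *\<^sub>R c (Suc k + j)) =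
      (\<Sum>j<r. B j *\<^sub>R c (Suc k + j)) + B r *\<^sub>R c (Suc k + r)"
    by (simp add: atMost_atLeast0[symmetric] lessThan_Suc_atMost[symmetric])
  have "(\<Sum>j=0..Suc r. F j *\<^sub>R c (k + j)) =
      F 0 *\<^sub>R c k + (\<Sum>j<Suc r. F (Suc j) *\<^sub>R c (Suc k + j))"
    by (simp add: atMost_atLeast0[symmetric] lessThan_Suc_atMost[symmetric]
        sum.lessThan_Suc_shift del: sum.lessThan_Suc)
  also have "\<dots> = F 0 *\<^sub>R c k +
      ((\<Sum>j<r. (s * A (Suc j) + t * B j) *\<^sub>R c (Suc k + j)) + F (Suc r) *\<^sub>R c (Suc k + r))"
    using assms(3) by simp
  finally show ?thesis
    unfolding A B assms(1,2)
    by (simp add: scaleR_add_left scaleR_add_right sum.distrib scaleR_sum_right)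
qed

section \<open>Closed forms of the two algorithms\<close>

text \<open>At the control point \<open>k+j+1\<close> the new power is \<open>q^(k(r-j))\<close>.
  The first summand supplies \<open>k + k(r-j-1) = k(r-j)\<close>, the second
  \<open>(k+1)(r-j)\<close>; the surplus \<open>q^(r-j)\<close> is the one in the first q-Pascal
  identity.\<close>

lemma casteljau1_eq:
  assumes "qfact n q \<noteq> 0" "k + r \<le> n"
  shows "casteljau1 a b q n c x r k =
    (\<Sum>j=0..r. (q ^ (k * (r - j)) * qbinom r j q * qtrig_weight a b q n x r k j) *\<^sub>R c (k + j))"
  using assms(2)
proof (induction r arbitrary: k)
  case 0
  then show ?case by (simp add: qbinom_0)
next
  case (Suc r)
  have nz: "qfact (Suc r) q \<noteq> 0" "qfact r q \<noteq> 0"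
    using qfact_nonzero_mono[OF assms(1), of "Suc r"] qfact_nonzero_mono[OF assms(1), of r] Suc.prems
    by simp_all
  have kr: "k + r < n"
    using Suc.prems by simp
  let ?s = "q ^ k * (qd x b (q ^ (n - r - k - 1)) / qd a b (q ^ (n - r - 1)))"
  let ?t = "qd a x (q ^ k) / qd a b (q ^ (n - r - 1))"
  have "casteljau1 a b q n c x (Suc r) k =
      ?s *\<^sub>R casteljau1 a b q n c x r k + ?t *\<^sub>R casteljau1 a b q n c x r (Suc k)"
    by simp
  also have "\<dots> =
      ?s *\<^sub>R (\<Sum>j=0..r. (q ^ (k * (r - j)) * qbinom r j q * qtrig_weight a b q n x r k j) *\<^sub>R c (k + j)) +
      ?t *\<^sub>R (\<Sum>j=0..r. (q ^ (Suc k * (r - j)) * qbinom r j q *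
        qtrig_weight a b q n x r (Suc k) j) *\<^sub>R c (Suc k + j))"
    using Suc.IH[of k] Suc.IH[of "Suc k"] Suc.prems by simp
  also have "\<dots> = (\<Sum>j=0..Suc r. (q ^ (k * (Suc r - j)) * qbinom (Suc r) j q *
      qtrig_weight a b q n x (Suc r) k j) *\<^sub>R c (k + j))"
  proof (rule sum_scaleR_two_term_recursion, goal_cases)
    case 1
    show ?case
      unfolding qtrig_weight_Suc_left[OF kr le0] qbinom_0[OF nz(1)] qbinom_0[OF nz(2)]
      by (simp add: power_add)
  next
    case 2
    show ?case
      unfolding qtrig_weight_Suc_right[OF kr order_refl] qbinom_self[OF nz(1)] qbinom_self[OF nz(2)]
      by simp
  next
    case (3 j)
    let ?w = "qtrig_weight a b q n x (Suc r) k (Suc j)"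
    have left: "?w = qd x b (q ^ (n - r - k - 1)) / qd a b (q ^ (n - r - 1)) *
        qtrig_weight a b q n x r k (Suc j)"
      using 3 by (intro qtrig_weight_Suc_left[OF kr]) simp
    have right: "?w = ?t * qtrig_weight a b q n x r (Suc k) j"
      using 3 by (intro qtrig_weight_Suc_right[OF kr]) simp
    \<comment> \<open>Here \<open>j < r\<close> matters: \<open>r - j\<close> is the successor of
      \<open>r - Suc j\<close>.\<close>
    have exps: "q ^ (k * (r - j)) = q ^ k * q ^ (k * (r - Suc j))"
      by (simp only: Suc_diff_Suc[OF 3, symmetric] mult_Suc_right power_add)
    have "q ^ (k * (Suc r - Suc j)) * qbinom (Suc r) (Suc j) q * ?w =
        q ^ (k * (r - j)) * qbinom r (Suc j) q * ?w +
        q ^ (Suc k * (r - j)) * qbinom r j q * ?w"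
      unfolding qbinom_Suc_Suc(1)[OF nz(1) 3]
      by (simp only: diff_Suc_Suc mult_Suc power_add distrib_left distrib_right ac_simps)
    also have "q ^ (k * (r - j)) * qbinom r (Suc j) q * ?w =
        ?s * (q ^ (k * (r - Suc j)) * qbinom r (Suc j) q * qtrig_weight a b q n x r k (Suc j))"
      unfolding left exps by simp
    also have "q ^ (Suc k * (r - j)) * qbinom r j q * ?w =
        ?t * (q ^ (Suc k * (r - j)) * qbinom r j q * qtrig_weight a b q n x r (Suc k) j)"
      unfolding right by simp
    finally show ?case .
  qed
  finally show ?case .
qed

text \<open>With \<open>m = n-r-k-1\<close>, the new power at the control point \<open>k+j+1\<close>
  is \<open>q^((j+1)m)\<close>. The second summand supplies exactly \<open>m + jm\<close>, the first
  \<open>(j+1)(m+1)\<close>; the surplus \<open>q^(j+1)\<close> is the one in the second q-Pascal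
  identity.\<close>

lemma casteljau2_eq:
  assumes "qfact n q \<noteq> 0" "k + r \<le> n"
  shows "casteljau2 a b q n c x r k =
    (\<Sum>j=0..r. (q ^ (j * (n - r - k)) * qbinom r j q * qtrig_weight a b q n x r k j) *\<^sub>R c (k + j))"
  using assms(2)
proof (induction r arbitrary: k)
  case 0
  then show ?case by (simp add: qbinom_0)
next
  case (Suc r)
  have nz: "qfact (Suc r) q \<noteq> 0" "qfact r q \<noteq> 0"
    using qfact_nonzero_mono[OF assms(1), of "Suc r"] qfact_nonzero_mono[OF assms(1), of r] Suc.prems
    by simp_all
  have kr: "k + r < n"
    using Suc.prems by simp
  \<comment> \<open>The quantity \<open>n - r - k\<close> takes the value \<open>m + 1\<close> at
    \<open>(r, k)\<close> and \<open>m\<close> at both \<open>(r, k+1)\<close> and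
    \<open>(r+1, k)\<close>.\<close>
  define m where "m = n - r - k - 1"
  have m: "n - r - k = Suc m" "n - r - Suc k = m" "n - Suc r - k = m"
    using kr by (simp_all add: m_def)
  let ?s = "qd x b (q ^ (n - r - k - 1)) / qd a b (q ^ (n - r - 1))"
  let ?t = "q ^ m * (qd a x (q ^ k) / qd a b (q ^ (n - r - 1)))"
  have "casteljau2 a b q n c x (Suc r) k =
      ?s *\<^sub>R casteljau2 a b q n c x r k + ?t *\<^sub>R casteljau2 a b q n c x r (Suc k)"
    by (simp add: m_def)
  also have "\<dots> =
      ?s *\<^sub>R (\<Sum>j=0..r. (q ^ (j * Suc m) * qbinom r j q * qtrig_weight a b q n x r k j) *\<^sub>R c (k + j)) +
      ?t *\<^sub>R (\<Sum>j=0..r. (q ^ (j * m) * qbinom r j q *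
        qtrig_weight a b q n x r (Suc k) j) *\<^sub>R c (Suc k + j))"
    using Suc.IH[of k] Suc.IH[of "Suc k"] Suc.prems unfolding m by simp
  also have "\<dots> = (\<Sum>j=0..Suc r. (q ^ (j * m) * qbinom (Suc r) j q *
      qtrig_weight a b q n x (Suc r) k j) *\<^sub>R c (k + j))"
  proof (rule sum_scaleR_two_term_recursion, goal_cases)
    case 1
    show ?case
      unfolding qtrig_weight_Suc_left[OF kr le0] qbinom_0[OF nz(1)] qbinom_0[OF nz(2)]
      by simp
  next
    case 2
    show ?case
      unfolding qtrig_weight_Suc_right[OF kr order_refl] qbinom_self[OF nz(1)] qbinom_self[OF nz(2)]
      by (simp add: power_add)
  next
    case (3 j)
    let ?w = "qtrig_weight a b q n x (Suc r) k (Suc j)"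
    have left: "?w = ?s * qtrig_weight a b q n x r k (Suc j)"
      using 3 by (intro qtrig_weight_Suc_left[OF kr]) simp
    have right: "?w = qd a x (q ^ k) / qd a b (q ^ (n - r - 1)) *
        qtrig_weight a b q n x r (Suc k) j"
      using 3 by (intro qtrig_weight_Suc_right[OF kr]) simp
    have exps: "q ^ (Suc j * Suc m) = q ^ Suc j * q ^ (Suc j * m)"
      "q ^ (Suc j * m) = q ^ m * q ^ (j * m)"
      by (simp_all add: power_add)
    have "q ^ (Suc j * m) * qbinom (Suc r) (Suc j) q * ?w =
        q ^ (Suc j * Suc m) * qbinom r (Suc j) q * ?w + q ^ (Suc j * m) * qbinom r j q * ?w"
      unfolding qbinom_Suc_Suc(2)[OF nz(1) 3] exps(1) by (simp only: algebra_simps)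
    also have "q ^ (Suc j * Suc m) * qbinom r (Suc j) q * ?w =
        ?s * (q ^ (Suc j * Suc m) * qbinom r (Suc j) q * qtrig_weight a b q n x r k (Suc j))"
      unfolding left by (simp only: ac_simps)
    also have "q ^ (Suc j * m) * qbinom r j q * ?w =
        ?t * (q ^ (j * m) * qbinom r j q * qtrig_weight a b q n x r (Suc k) j)"
      unfolding right exps(2) by (simp only: ac_simps)
    finally show ?case .
  qed
  finally show ?case
    unfolding m .
qed

text \<open>For \<open>r = n\<close> and \<open>k = 0\<close> all exponents in the weight collapse
  to \<open>i\<close>, which gives the quotient in the Bernstein basis.\<close>

lemma qtrig_bezier_eq:
  "qtrig_bezier a b q n c x = (\<Sum>j=0..n. (qbinom n j q * qtrig_weight a b q n x n 0 j) *\<^sub>R c j)"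
  by (simp add: qtrig_bezier_def qtrig_bernstein_def qtrig_weight_def)

theorem theorem3p2:
  fixes n :: nat and a b q :: real and c :: "nat \<Rightarrow> real ^ 'm"
  assumes "n \<ge> 1"
    and "a < b"
    and "qfact n q \<noteq> 0"
    and "\<And>i. i \<le> n \<Longrightarrow> qd a b (q ^ i) \<noteq> 0"
  shows "(\<forall>r\<le>n. \<forall>k\<le>n - r. \<forall>x\<in>{a..b}.
            casteljau1 a b q n c x r k =
              (\<Sum>j=0..r. (q ^ (k * (r - j)) * qbinom r j q *
                 (((\<Prod>i<j. qd a x (q ^ (i + k))) *
                   (\<Prod>i<r - j. qd x b (q ^ (i + n - r - k)))) /
                  (\<Prod>i<r. qd a b (q ^ (i + n - r))))) *\<^sub>R c (k + j)) \<and>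
            casteljau2 a b q n c x r k =
              (\<Sum>j=0..r. (q ^ (j * (n - r - k)) * qbinom r j q *
                 (((\<Prod>i<j. qd a x (q ^ (i + k))) *
                   (\<Prod>i<r - j. qd x b (q ^ (i + n - r - k)))) /
                  (\<Prod>i<r. qd a b (q ^ (i + n - r))))) *\<^sub>R c (k + j))) \<and>
         (\<forall>x\<in>{a..b}.
            casteljau1 a b q n c x n 0 = qtrig_bezier a b q n c x \<and>
            casteljau2 a b q n c x n 0 = qtrig_bezier a b q n c x)"
proof (intro conjI allI impI ballI)
  fix r k x
  assume "r \<le> n" "k \<le> n - r"
  then have kr: "k + r \<le> n"
    by simp
  note eqs = casteljau1_eq[OF assms(3) kr] casteljau2_eq[OF assms(3) kr]
  show "casteljau1 a b q n c x r k =
      (\<Sum>j=0..r. (q ^ (k * (r - j)) * qbinom r j q *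
         (((\<Prod>i<j. qd a x (q ^ (i + k))) * (\<Prod>i<r - j. qd x b (q ^ (i + n - r - k)))) /
          (\<Prod>i<r. qd a b (q ^ (i + n - r))))) *\<^sub>R c (k + j))"
    by (rule eqs(1)[unfolded qtrig_weight_def])
  show "casteljau2 a b q n c x r k =
      (\<Sum>j=0..r. (q ^ (j * (n - r - k)) * qbinom r j q *
         (((\<Prod>i<j. qd a x (q ^ (i + k))) * (\<Prod>i<r - j. qd x b (q ^ (i + n - r - k)))) /
          (\<Prod>i<r. qd a b (q ^ (i + n - r))))) *\<^sub>R c (k + j))"
    by (rule eqs(2)[unfolded qtrig_weight_def])
next
  fix x
  show "casteljau1 a b q n c x n 0 = qtrig_bezier a b q n c x"
    \<comment> \<open>At \<open>r = n\<close>, \<open>k = 0\<close> the extra exponents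
      \<open>k(r-j)\<close> and \<open>j(n-r-k)\<close> both vanish, so the two algorithms end in
      the same point.\<close>
    by (simp add: casteljau1_eq[OF assms(3)] qtrig_bezier_eq)
  show "casteljau2 a b q n c x n 0 = qtrig_bezier a b q n c x"
    by (simp add: casteljau2_eq[OF assms(3)] qtrig_bezier_eq)
qed

end
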